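(* Let $\delta>0$. Suppose that in the quantum winning strategy for the Mermin-GHZ game Alice (player 1) performs the unitary transformation $U$ imperfectly with random error with bound $\delta$ (i.e. she applies $U_\epsilon$ in place of $U$, where $\epsilon$ is uniformly distributed on $[-\delta,\delta]$), all other steps being performed correctly. Then for any inputs $x_1,x_2,x_3\in\{0,1\}$ satisfying the promise $x_1\oplus x_2\oplus x_3=0$, the strategy gives a correct answer with probability $$P_{\delta}(x_1,x_2,x_3)=\begin{cases}1 & \text{if } x_1=0,\\ \dfrac{\delta+\sin\delta}{2\delta} & \text{otherwise.}\end{cases}$$ Moreover, for a question $(x_1,x_2,x_3)$ chosen uniformly at random from the promise set $P$, it gives a correct answer with probability $$P_{\delta}=\frac12+\frac{\delta+\sin\delta}{4\delta}.$$
   Context: Mermin-GHZ game: three players, Alice, Bob and Charles (players 1, 2, 3), receive input bits $x_1,x_2,x_3\in\{0,1\}$ respectively, with the promise that $(x_1,x_2,x_3)\in P=\{(x_1,x_2,x_3)\in\{0,1\}^3 : x_1\oplus x_2\oplus x_3=0\}$. Without communicating, they output bits $a_1,a_2,a_3$ respectively. The answer is correct if $a_1\oplus a_2\oplus a_3=x_1\lor x_2\lor x_3$. Quantum winning strategy: the players share the three-qubit state $|\varphi\rangle=\frac{1}{\sqrt2}(|000\rangle+|111\rangle)$, player $i$ holding the $i$-th qubit. On input $x_i$, player $i$ (1) applies to his or her qubit the unitary $U$ given by $U|0\rangle=|0\rangle$, $U|1\rangle=e^{\pi \imath x_i/2}|1\rangle$; (2) applies the Hadamard transformation $H=\frac{1}{\sqrt2}\begin{pmatrix}1&1\\1&-1\end{pmatrix}$;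 (3) measures the qubit in the computational basis and outputs the measured bit $a_i$. Here $\imath$ is the imaginary unit. Random error with bound $\delta$ in Alice's transformation $U$: $\epsilon$ is chosen uniformly at random from $[-\delta,\delta]$, and Alice applies, in step (1), instead of $U$ the unitary $U_\epsilon$ given by $U_\epsilon|0\rangle=|0\rangle$, $U_\epsilon|1\rangle=e^{(\frac{\pi}{2}+\epsilon)\imath x_1}|1\rangle$; everything else is unchanged. The probability of a correct answer is taken over both the choice of $\epsilon$ and the measurement outcomes (and, for $P_\delta$, over the uniformly random question, chosen independently of $\epsilon$). *)

theory Defs
  imports "HOL-Probability.Probability" "HOL-Library.Z2"
begin

unbundle bit_operations_syntax

instance bit :: finite
proof
  have "(UNIV :: bit set) = {0, 1}"
    using bit.exhaust by auto
  then show "finite (UNIV :: bit set)"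
    by (metis finite.emptyI finite.insertI)
qed

definition promise :: "(bit \<times> bit \<times> bit) set" where
  "promise = {(x\<^sub>1, x\<^sub>2, x\<^sub>3). x\<^sub>1 XOR x\<^sub>2 XOR x\<^sub>3 = 0}"

definition correct :: "bit \<times> bit \<times> bit \<Rightarrow> bit \<times> bit \<times> bit \<Rightarrow> bool" where
  "correct = (\<lambda>(x\<^sub>1, x\<^sub>2, x\<^sub>3) (a\<^sub>1, a\<^sub>2, a\<^sub>3).
     a\<^sub>1 XOR a\<^sub>2 XOR a\<^sub>3 = x\<^sub>1 OR x\<^sub>2 OR x\<^sub>3)"

text \<open>
  A qubit lives in \<^typ>\<open>complex ^ bit\<close>. Three qubits live in
  \<^typ>\<open>complex ^ (bit \<times> bit \<times> bit)\<close>, whose standard basis vectors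
  \<^term>\<open>axis (a\<^sub>1, a\<^sub>2, a\<^sub>3) 1\<close> are the computational basis states
  \<open>|a\<^sub>1 a\<^sub>2 a\<^sub>3>\<close>, that is, the tensor products of the one-qubit basis states.
  In an operator, \<^term>\<open>A $ i $ j\<close> is the coefficient of \<open>|i>\<close> in the image of \<open>|j>\<close>.
\<close>

definition tensor ::
    "complex ^ 'a ^ 'a \<Rightarrow> complex ^ 'b ^ 'b \<Rightarrow> complex ^ ('a \<times> 'b) ^ ('a \<times> 'b)" where
  "tensor A B = (\<chi> i j. A $ fst i $ fst j * B $ snd i $ snd j)"

definition ghz :: "complex ^ (bit \<times> bit \<times> bit)" where
  "ghz = complex_of_real (1 / sqrt 2) *s (axis (0, 0, 0) 1 + axis (1, 1, 1) 1)"

definition phase :: "real \<Rightarrow> complex ^ bit ^ bit" where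
  "phase \<theta> = (\<chi> i j. if i \<noteq> j then 0 else if j = 0 then 1 else exp (\<i> * complex_of_real \<theta>))"

definition U :: "bit \<Rightarrow> complex ^ bit ^ bit" where
  "U x = phase (pi * of_bit x / 2)"

definition U_err :: "real \<Rightarrow> bit \<Rightarrow> complex ^ bit ^ bit" where
  "U_err \<epsilon> x = phase ((pi / 2 + \<epsilon>) * of_bit x)"

definition hadamard :: "complex ^ bit ^ bit" where
  "hadamard = (\<chi> i j. complex_of_real (1 / sqrt 2) * (if i = 1 \<and> j = 1 then -1 else 1))"

text \<open>
  Born rule for measuring all qubits in the computational basis: outcome \<open>a\<close> has
  probability \<open>|\<langle>a|\<psi>\<rangle>|\<^sup>2\<close>. This is a probability measure whenever \<open>\<psi>\<close> is a unit vector.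
\<close>

definition measurement :: "complex ^ 'n \<Rightarrow> 'n measure" where
  "measurement \<psi> = point_measure UNIV (\<lambda>a. ennreal ((cmod (\<psi> $ a))\<^sup>2))"

definition final_state :: "real \<Rightarrow> bit \<times> bit \<times> bit \<Rightarrow> complex ^ (bit \<times> bit \<times> bit)" where
  "final_state \<epsilon> = (\<lambda>(x\<^sub>1, x\<^sub>2, x\<^sub>3).
     tensor hadamard (tensor hadamard hadamard) *v
       (tensor (U_err \<epsilon> x\<^sub>1) (tensor (U x\<^sub>2) (U x\<^sub>3)) *v ghz))"

definition error_dist :: "real \<Rightarrow> real measure" where
  "error_dist \<delta> = uniform_measure lborel {-\<delta>..\<delta>}"

definition answers :: "real \<Rightarrow> bit \<times> bit \<times> bit \<Rightarrow> (bit \<times> bit \<times> bit) measure" where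
  "answers \<delta> x = error_dist \<delta> \<bind> (\<lambda>\<epsilon>. measurement (final_state \<epsilon> x))"

text \<open>
  The question is independent of the error, which is why the two are drawn from a
  product measure. The question is kept next to the answers in the resulting law.
\<close>

definition game ::
    "real \<Rightarrow> ((bit \<times> bit \<times> bit) \<times> (bit \<times> bit \<times> bit)) measure" where
  "game \<delta> =
     (measure_pmf (pmf_of_set promise) \<Otimes>\<^sub>M error_dist \<delta>) \<bind>
       (\<lambda>(x, \<epsilon>). distr (measurement (final_state \<epsilon> x)) (count_space UNIV) (Pair x))"

definition success_prob :: "real \<Rightarrow> bit \<times> bit \<times> bit \<Rightarrow> real" where
  "success_prob \<delta> x = measure (answers \<delta> x) {a. correct x a}"

definition random_success_prob :: "real \<Rightarrow> real" where
  "random_success_prob \<delta> = measure (game \<delta>) {(x, a). correct x a}"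

end

theory Submission
  imports Defs
begin

text \<open>
  On GHZ, three phase gates act only through the sum \<open>\<phi>\<close> of their angles, and after the Hadamard
  gates the outcome \<open>a\<close> has amplitude \<open>(1 \<plusminus> e\<^sup>i\<^sup>\<phi>) / 4\<close> with the sign given by the parity of \<open>a\<close>.
  Hence a given parity occurs with probability \<open>(1 \<plusminus> cos \<phi>) / 2\<close>. On the promise set, \<open>\<phi>\<close>
  is \<open>0\<close> or \<open>\<pi>\<close> as the correct parity demands, plus \<open>\<epsilon>\<close> if \<open>x\<^sub>1 = 1\<close>; so an error
  \<open>\<epsilon>\<close> leaves success probability \<open>(1 + cos \<epsilon>) / 2\<close>, which is averaged over \<open>[-\<delta>, \<delta>]\<close>.
\<close>

lemma UNIV_bit: "(UNIV :: bit set) = {0, 1}"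
  using bit.exhaust by auto

lemma sum_bit: "sum f (UNIV :: bit set) = f 0 + f 1"
  by (simp add: UNIV_bit)

lemma sum_pair_UNIV:
  "sum f (UNIV :: ('a::finite \<times> 'b::finite) set) = (\<Sum>i\<in>UNIV. \<Sum>j\<in>UNIV. f (i, j))"
  by (simp add: sum.cartesian_product flip: UNIV_Times_UNIV)

definition phased_ghz :: "real \<Rightarrow> complex ^ (bit \<times> bit \<times> bit)" where
  "phased_ghz \<phi> = complex_of_real (1 / sqrt 2) *s (axis (0, 0, 0) 1 + axis (1, 1, 1) (cis \<phi>))"

text \<open>Phase gates are diagonal and fix |0>, so |000> is unchanged while |111> collects the
  product of the three phase factors.\<close>

lemma phase_ghz:
  "tensor (phase \<alpha>) (tensor (phase \<beta>) (phase \<gamma>)) *v ghz = phased_ghz (\<alpha> + \<beta> + \<gamma>)"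
  by (auto simp: vec_eq_iff matrix_vector_mult_def tensor_def phase_def ghz_def phased_ghz_def
      sum_pair_UNIV sum_bit axis_def cis_conv_exp algebra_simps simp flip: exp_add)

text \<open>Only the columns of |000> and |111> matter: their entries in row (a, b, c) have modulus
  1/(2 sqrt 2), the second with sign (-1)^(a+b+c).\<close>

lemma hadamard_phased_ghz:
  "(tensor hadamard (tensor hadamard hadamard) *v phased_ghz \<phi>) $ (a, b, c) =
     (1 + (if a XOR b XOR c = 0 then 1 else -1) * cis \<phi>) / 4"
proof -
  \<comment> \<open>Three Hadamard gates and the normalisation of the state give four factors 1/sqrt
    2, hence the 4 in the denominator.\<close>
  have "complex_of_real (sqrt 2) * complex_of_real (sqrt 2) = 2"
    by (simp flip: of_real_mult)
  then show ?thesis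
    by (cases a; cases b; cases c)
      (simp_all add: matrix_vector_mult_def tensor_def hadamard_def phased_ghz_def
      sum_pair_UNIV sum_bit axis_def field_simps)
qed

text \<open>The squared modulus of 1 + s e^(i \<phi>) with s = 1 or s = -1 is 2 + 2 s cos \<phi>;
  dividing by 16 leaves the denominator 8.\<close>

lemma amplitude_squared:
  "(cmod (final_state \<epsilon> (x, y, z) $ (a, b, c)))\<^sup>2 =
     (1 + (if a XOR b XOR c = 0 then 1 else -1) *
       cos ((pi / 2 + \<epsilon>) * of_bit x + pi * of_bit y / 2 + pi * of_bit z / 2)) / 8"
proof -
  have "(cmod ((1 + cis \<phi>) / 4))\<^sup>2 = (1 + cos \<phi>) / 8" for \<phi>
    unfolding cmod_power2
    by (simp add: field_simps power2_eq_square; use sin_cos_squared_add3[of \<phi>] in algebra)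
  moreover have "(cmod ((1 - cis \<phi>) / 4))\<^sup>2 = (1 - cos \<phi>) / 8" for \<phi>
    unfolding cmod_power2
    by (simp add: field_simps power2_eq_square; use sin_cos_squared_add3[of \<phi>] in algebra)
  ultimately show ?thesis
    by (auto simp: final_state_def U_err_def U_def phase_ghz hadamard_phased_ghz
        simp del: of_bool_eq_iff)
qed

lemma sets_measurement [simp]: "sets (measurement \<psi>) = UNIV"
  by (simp add: measurement_def sets_point_measure)

lemma space_measurement [simp]: "space (measurement \<psi>) = UNIV"
  by (simp add: measurement_def space_point_measure)

lemma measure_measurement:
  fixes \<psi> :: "complex ^ 'n::finite"
  shows "measure (measurement \<psi>) A = (\<Sum>a\<in>A. (cmod (\<psi> $ a))\<^sup>2)"
  by (simp add: measurement_def measure_point_measure_finite_if)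

lemma emeasure_measurement:
  fixes \<psi> :: "complex ^ 'n::finite"
  shows "emeasure (measurement \<psi>) A = ennreal (\<Sum>a\<in>A. (cmod (\<psi> $ a))\<^sup>2)"
  by (simp add: measurement_def emeasure_point_measure_finite)

text \<open>Each parity has four outcomes, so the cosine terms cancel in the total; unitarity of the
  gates is not invoked.\<close>

lemma prob_space_measurement_final_state: "prob_space (measurement (final_state \<epsilon> x))"
proof
  obtain p q r where "x = (p, q, r)" by (cases x)
  then show "emeasure (measurement (final_state \<epsilon> x)) (space (measurement (final_state \<epsilon> x))) = 1"
    by (simp add: emeasure_measurement amplitude_squared sum_pair_UNIV sum_bit
        add_divide_distrib diff_divide_distrib)
qed

lemma measurable_measurement_final_state:
  "(\<lambda>\<epsilon>. measurement (final_state \<epsilon> x)) \<in> borel \<rightarrow>\<^sub>M subprob_algebra (count_space UNIV)"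
proof (rule measurable_subprob_algebra)
  fix A :: "(bit \<times> bit \<times> bit) set"
  obtain p q r where "x = (p, q, r)" by (cases x)
  then have "(\<lambda>\<epsilon>. (cmod (final_state \<epsilon> x $ a))\<^sup>2) \<in> borel_measurable borel" for a
    \<comment> \<open>The closed form reduces measurability to that of the cosine.\<close>
    by (cases a) (simp only: amplitude_squared, measurable)
  then show "(\<lambda>\<epsilon>. emeasure (measurement (final_state \<epsilon> x)) A) \<in> borel_measurable borel"
    unfolding emeasure_measurement by measurable
qed (simp_all add: prob_space_measurement_final_state prob_space_imp_subprob_space)

lemma measure_correct:
  assumes "(x, y, z) \<in> promise"
  shows "measure (measurement (final_state \<epsilon> (x, y, z))) {a. correct (x, y, z) a} =
    (if x = 0 then 1 else (1 + cos \<epsilon>) / 2)"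
proof -
  have "measure (measurement (final_state \<epsilon> (x, y, z))) {a. correct (x, y, z) a} =
    (\<Sum>a\<in>UNIV. if correct (x, y, z) a then (cmod (final_state \<epsilon> (x, y, z) $ a))\<^sup>2 else 0)"
    by (simp add: measure_measurement flip: sum.inter_filter)
  also have "\<dots> = (if x = 0 then 1 else (1 + cos \<epsilon>) / 2)"
    using assms
    by (cases x; cases y; cases z)
      (simp_all add: promise_def correct_def amplitude_squared sum_pair_UNIV sum_bit cos_add
        add_divide_distrib diff_divide_distrib)
  finally show ?thesis .
qed

lemma prob_space_error_dist: "\<delta> > 0 \<Longrightarrow> prob_space (error_dist \<delta>)"
  unfolding error_dist_def by (rule prob_space_uniform_measure) auto

lemma expectation_cos_error_dist:
  assumes "\<delta> > 0"
  shows "(\<integral>\<epsilon>. (1 + cos \<epsilon>) / 2 \<partial>error_dist \<delta>) = (\<delta> + sin \<delta>) / (2 * \<delta>)"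
proof -
  \<comment> \<open>The interval has length 2 \<delta>, so the uniform law has constant density on
    it.\<close>
  have "error_dist \<delta> = density lborel (\<lambda>\<epsilon>. ennreal (indicator {-\<delta>..\<delta>} \<epsilon> / (2 * \<delta>)))"
    using assms unfolding error_dist_def uniform_measure_def
    by (intro density_cong) (auto simp: indicator_def divide_ennreal
        simp flip: ennreal_1 split: if_splits)
  then have "(\<integral>\<epsilon>. (1 + cos \<epsilon>) / 2 \<partial>error_dist \<delta>) =
      (\<integral>\<epsilon>. indicator {-\<delta>..\<delta>} \<epsilon> *\<^sub>R ((1 + cos \<epsilon>) / (4 * \<delta>)) \<partial>lborel)"
    using assms by (simp add: integral_real_density field_simps)
  \<comment> \<open>The antiderivative is (\<epsilon> + sin \<epsilon>) / (4 \<delta>).\<close>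
  also have "\<dots> = (\<delta> + sin \<delta>) / (4 * \<delta>) - (-\<delta> + sin (-\<delta>)) / (4 * \<delta>)"
    using assms
    by (intro integral_FTC_Icc) (auto intro!: derivative_eq_intros continuous_intros
        simp: divide_simps simp flip: has_real_derivative_iff_has_vector_derivative)
  also have "\<dots> = (\<delta> + sin \<delta>) / (2 * \<delta>)"
    using assms by (simp add: field_simps)
  finally show ?thesis .
qed

lemma success_prob_promise:
  assumes "\<delta> > 0" "(x, y, z) \<in> promise"
  shows "success_prob \<delta> (x, y, z) = (if x = 0 then 1 else (\<delta> + sin \<delta>) / (2 * \<delta>))"
proof -
  interpret prob_space "error_dist \<delta>"
    using assms(1) by (rule prob_space_error_dist)
  have "(\<lambda>\<epsilon>. measurement (final_state \<epsilon> (x, y, z))) \<in>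
      error_dist \<delta> \<rightarrow>\<^sub>M subprob_algebra (count_space UNIV)"
    using measurable_measurement_final_state by (simp add: error_dist_def)
  then show ?thesis
    unfolding success_prob_def answers_def
    \<comment> \<open>The deleted rules would pull the division out of the integral and hide the
      form of \<open>expectation_cos_error_dist\<close>.\<close>
    using assms by (simp add: measure_bind measure_correct expectation_cos_error_dist prob_space
        del: integral_divide_zero Bochner_Integration.integral_divide)
qed

text \<open>By independence, Fubini allows integrating over the error first with the question fixed;
  this inner integral is \<open>success_prob\<close>.\<close>

lemma random_success_prob_eq_average:
  assumes "\<delta> > 0"
  shows "random_success_prob \<delta> = (\<Sum>x\<in>promise. success_prob \<delta> x) / card promise"
proof -
  have ne: "promise \<noteq> {}" by (auto simp: promise_def)
  interpret E: prob_space "error_dist \<delta>"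
    using assms by (rule prob_space_error_dist)
  interpret Q: pair_prob_space "measure_pmf (pmf_of_set promise)" "error_dist \<delta>" ..
  let ?K = "\<lambda>(x, \<epsilon>). distr (measurement (final_state \<epsilon> x)) (count_space UNIV) (Pair x)"
  have meas: "(\<lambda>\<epsilon>. measurement (final_state \<epsilon> x)) \<in>
      error_dist \<delta> \<rightarrow>\<^sub>M subprob_algebra (count_space UNIV)" for x
    using measurable_measurement_final_state by (simp add: error_dist_def)
  have "(\<lambda>\<epsilon>. distr (measurement (final_state \<epsilon> x)) (count_space UNIV) (Pair x)) \<in>
      error_dist \<delta> \<rightarrow>\<^sub>M subprob_algebra (count_space UNIV)" for x
    using measurable_compose[OF meas
        measurable_distr[of "Pair x" "count_space UNIV" "count_space UNIV"]] by simp
  then have "?K \<in> count_space UNIV \<Otimes>\<^sub>M error_dist \<delta> \<rightarrow>\<^sub>M subprob_algebra (count_space UNIV)"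
    \<comment> \<open>There are finitely many questions, so measurability in \<epsilon> for each one
      suffices.\<close>
    by (intro measurable_pair_measure_countable1) auto
  then have K: "?K \<in> measure_pmf (pmf_of_set promise) \<Otimes>\<^sub>M error_dist \<delta> \<rightarrow>\<^sub>M
      subprob_algebra (count_space UNIV)"
    by (subst measurable_cong_sets[OF sets_pair_measure_cong refl]) simp_all
  have *: "measure (?K (x, \<epsilon>)) {(x, a). correct x a} =
      measure (measurement (final_state \<epsilon> x)) {a. correct x a}" for x \<epsilon>
    by (simp add: measure_distr vimage_def measurable_def)
  have "random_success_prob \<delta> = (\<integral>p. measure (?K p) {(x, a). correct x a}
      \<partial>(measure_pmf (pmf_of_set promise) \<Otimes>\<^sub>M error_dist \<delta>))"
    unfolding random_success_prob_def game_def by (rule Q.measure_bind[OF K]) simp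
  also have "\<dots> = (\<integral>x. \<integral>\<epsilon>. measure (?K (x, \<epsilon>)) {(x, a). correct x a} \<partial>error_dist \<delta>
      \<partial>measure_pmf (pmf_of_set promise))"
    \<comment> \<open>Fubini needs integrability: the integrand is measurable and, being a
      probability, bounded by 1.\<close>
    by (rule Q.integral_fst'[symmetric], rule Q.integrable_const_bound[where B=1])
     (use measure_measurable_subprob_algebra2[OF _ K] in
       \<open>auto intro!: subprob_space.subprob_measure_le_1 subprob_space_kernel[OF K]
         simp: space_pair_measure\<close>)
  also have "\<dots> = (\<integral>x. success_prob \<delta> x \<partial>measure_pmf (pmf_of_set promise))"
    unfolding * success_prob_def answers_def by (simp add: E.measure_bind[OF meas])
  also have "\<dots> = (\<Sum>x\<in>promise. success_prob \<delta> x) / card promise"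
    using ne by (simp add: integral_pmf_of_set)
  finally show ?thesis .
qed

lemma promise_eq: "promise = {(0, 0, 0), (0, 1, 1), (1, 0, 1), (1, 1, 0)}"
proof -
  have "(x, y, z) \<in> promise \<longleftrightarrow> (x, y, z) \<in> {(0, 0, 0), (0, 1, 1), (1, 0, 1), (1, 1, 0)}" for x y z
    by (cases x; cases y; cases z) (simp_all add: promise_def)
  then show ?thesis by auto
qed

theorem theorem2:
  fixes \<delta> :: real
  assumes "\<delta> > 0"
  shows "(\<forall>x\<^sub>1 x\<^sub>2 x\<^sub>3 :: bit. x\<^sub>1 XOR x\<^sub>2 XOR x\<^sub>3 = 0 \<longrightarrow>
           success_prob \<delta> (x\<^sub>1, x\<^sub>2, x\<^sub>3) = (if x\<^sub>1 = 0 then 1 else (\<delta> + sin \<delta>) / (2 * \<delta>)))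
       \<and> random_success_prob \<delta> = 1 / 2 + (\<delta> + sin \<delta>) / (4 * \<delta>)"
proof (intro conjI allI impI)
  fix x y z :: bit
  assume "x XOR y XOR z = 0"
  then show "success_prob \<delta> (x, y, z) = (if x = 0 then 1 else (\<delta> + sin \<delta>) / (2 * \<delta>))"
    by (intro success_prob_promise assms) (simp add: promise_def)
next
  \<comment> \<open>Two questions have first bit 0 and contribute 1 each; the other two contribute
    (\<delta> + sin \<delta>) / (2 \<delta>) each.\<close>
  have "(\<Sum>x\<in>promise. success_prob \<delta> x) = 2 + (\<delta> + sin \<delta>) / \<delta>"
    using assms by (simp add: promise_eq success_prob_promise[OF assms] field_simps)
  moreover have "card promise = 4"
    by (simp add: promise_eq)
  ultimately show "random_success_prob \<delta> = 1 / 2 + (\<delta> + sin \<delta>) / (4 * \<delta>)"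
    using assms by (simp add: random_success_prob_eq_average field_simps)
qed

end
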